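(* Let $X$ be a $\mathbb{Z}^n$-periodic discrete metric space with $N$ orbits and let $p\in[1,\infty]$. Then the map $A\mapsto UAU^{-1}$ is an isomorphism of Banach algebras from $\mathcal{A}_p(X)$ onto $\mathcal{A}_p(\mathbb{Z}^n,\mathbb{C}^N)$.
   Context: A discrete metric space is a countable set $X$ with a metric $\rho$ such that every ball is finite. It is $\mathbb{Z}^n$-periodic if $\mathbb{Z}^n$ acts on $X$ by $\rho$-isometries, $(\alpha,x)\mapsto\alpha\cdot x$ (with $0\cdot x=x$, $(\alpha+\beta)\cdot x=\alpha\cdot(\beta\cdot x)$), freely, with finitely many orbits; $x_1,\dots,x_N$ are fixed orbit representatives. $U:l^p(X)\to l^p(\mathbb{Z}^n,\mathbb{C}^N)$, $(Uf)(\alpha)=(f(\alpha\cdot x_1),\dots,f(\alpha\cdot x_N))$. A band operator on $l^p(X)$ is a linear operator $A$ with bounded generating function $k_A$ (i.e. $(Au)(x)=\sum_y k_A(x,y)u(y)$ for finitely supported $u$) such that $k_A(x,y)=0$ whenever $\rho(x,y)>R$ for some $R$. $\mathcal{A}_p(X)$ is the closure in $\mathcal{L}(l^p(X))$ of the band operators. A band operator on $l^p(\mathbb{Z}^n,\mathbb{C}^N)$ is an operator $\sum_{|\alpha|\le m}a_\alpha V_\alpha$ with $a_\alpha\in l^\infty(\mathbb{Z}^n,\mathbb{C}^{N\times N})$ acting by multiplication and $(V_\alpha u)(x)=u(x-\alpha)$; $\mathcal{A}_p(\mathbb{Z}^n,\mathbb{C}^N)$ is the closure of these in $\mathcal{L}(l^p(\mathbb{Z}^n,\mathbb{C}^N))$.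 *)

theory Defs
  imports "HOL-Analysis.Analysis"
begin

section \<open>l^p spaces of functions, p in [1,infinity]\<close>

definition in_lp :: "ennreal \<Rightarrow> ('a \<Rightarrow> 'b::real_normed_vector) \<Rightarrow> bool" where
  "in_lp p f \<longleftrightarrow>
     (if p = \<infinity> then bounded (range (\<lambda>x. norm (f x)))
      else (\<lambda>x. norm (f x) powr enn2real p) summable_on UNIV)"

definition lp_norm :: "ennreal \<Rightarrow> ('a \<Rightarrow> 'b::real_normed_vector) \<Rightarrow> real" where
  "lp_norm p f =
     (if p = \<infinity> then (SUP x. norm (f x))
      else (infsum (\<lambda>x. norm (f x) powr enn2real p) UNIV) powr (1 / enn2real p))"

text \<open>Bounded linear operators on l^p; sm is the complex scalar multiplication of the
  value space. Operators are total functions, only their behaviour on l^p matters.\<close>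

definition lp_op :: "ennreal \<Rightarrow> (complex \<Rightarrow> 'b \<Rightarrow> 'b) \<Rightarrow>
     (('a \<Rightarrow> 'b::real_normed_vector) \<Rightarrow> ('a \<Rightarrow> 'b)) \<Rightarrow> bool" where
  "lp_op p sm T \<longleftrightarrow>
     (\<forall>u. in_lp p u \<longrightarrow> in_lp p (T u)) \<and>
     (\<forall>u v. in_lp p u \<longrightarrow> in_lp p v \<longrightarrow> T (\<lambda>x. u x + v x) = (\<lambda>x. T u x + T v x)) \<and>
     (\<forall>c u. in_lp p u \<longrightarrow> T (\<lambda>x. sm c (u x)) = (\<lambda>x. sm c (T u x))) \<and>
     (\<exists>C. \<forall>u. in_lp p u \<longrightarrow> lp_norm p (T u) \<le> C * lp_norm p u)"

definition op_norm :: "ennreal \<Rightarrow> (('a \<Rightarrow> 'b::real_normed_vector) \<Rightarrow> ('a \<Rightarrow> 'b)) \<Rightarrow> real" where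
  "op_norm p T = Sup {lp_norm p (T u) | u. in_lp p u \<and> lp_norm p u \<le> 1}"

section \<open>Band operators and their closures\<close>

text \<open>Band operator on l^p(X): bounded generating function k with band width R,
  (A u)(x) = sum over y of k(x,y) u(y) (a finite sum since balls are finite).\<close>

definition band_op_X :: "ennreal \<Rightarrow> ('x \<Rightarrow> 'x \<Rightarrow> real) \<Rightarrow>
     (('x \<Rightarrow> complex) \<Rightarrow> ('x \<Rightarrow> complex)) \<Rightarrow> bool" where
  "band_op_X p \<rho> A \<longleftrightarrow> lp_op p (*) A \<and>
     (\<exists>k :: 'x \<Rightarrow> 'x \<Rightarrow> complex. \<exists>R M.
        (\<forall>x y. norm (k x y) \<le> M) \<and>
        (\<forall>x y. \<rho> x y > R \<longrightarrow> k x y = 0) \<and>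
        (\<forall>u. in_lp p u \<longrightarrow> A u = (\<lambda>x. \<Sum>y\<in>{y. \<rho> x y \<le> R}. k x y * u y)))"

definition Ap_X :: "ennreal \<Rightarrow> ('x \<Rightarrow> 'x \<Rightarrow> real) \<Rightarrow>
     (('x \<Rightarrow> complex) \<Rightarrow> ('x \<Rightarrow> complex)) set" where
  "Ap_X p \<rho> = {A. lp_op p (*) A \<and>
     (\<forall>\<epsilon>>0. \<exists>B. band_op_X p \<rho> B \<and> op_norm p (\<lambda>u x. A u x - B u x) < \<epsilon>)}"

text \<open>Band operator on l^p(Z^n, C^N): sum over finitely many shifts alpha of
  a_alpha V_alpha with bounded matrix-valued coefficients a_alpha.\<close>

definition band_op_Z :: "ennreal \<Rightarrow>
     ((int^'n \<Rightarrow> complex^'k) \<Rightarrow> (int^'n \<Rightarrow> complex^'k)) \<Rightarrow> bool" where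
  "band_op_Z p A \<longleftrightarrow> lp_op p (*s) A \<and>
     (\<exists>S :: (int^'n) set. \<exists>a :: int^'n \<Rightarrow> int^'n \<Rightarrow> complex^'k^'k. \<exists>M.
        finite S \<and> (\<forall>\<alpha>\<in>S. \<forall>x. norm (a \<alpha> x) \<le> M) \<and>
        (\<forall>u. in_lp p u \<longrightarrow> A u = (\<lambda>x. \<Sum>\<alpha>\<in>S. a \<alpha> x *v u (x - \<alpha>))))"

definition Ap_Z :: "ennreal \<Rightarrow>
     ((int^'n \<Rightarrow> complex^'k) \<Rightarrow> (int^'n \<Rightarrow> complex^'k)) set" where
  "Ap_Z p = {A. lp_op p (*s) A \<and>
     (\<forall>\<epsilon>>0. \<exists>B. band_op_Z p B \<and> op_norm p (\<lambda>u x. A u x - B u x) < \<epsilon>)}"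

section \<open>Periodic discrete metric spaces and the map U\<close>

definition periodic_discrete_metric_space ::
  "('x \<Rightarrow> 'x \<Rightarrow> real) \<Rightarrow> (int^'n \<Rightarrow> 'x \<Rightarrow> 'x) \<Rightarrow> ('k::finite \<Rightarrow> 'x) \<Rightarrow> bool" where
  "periodic_discrete_metric_space \<rho> act reps \<longleftrightarrow>
     countable (UNIV :: 'x set) \<and>
     (\<forall>x y. \<rho> x y = 0 \<longleftrightarrow> x = y) \<and>
     (\<forall>x y. \<rho> x y = \<rho> y x) \<and>
     (\<forall>x y z. \<rho> x z \<le> \<rho> x y + \<rho> y z) \<and>
     (\<forall>x r. finite {y. \<rho> x y \<le> r}) \<and>
     (\<forall>x. act 0 x = x) \<and>
     (\<forall>\<alpha> \<beta> x. act (\<alpha> + \<beta>) x = act \<alpha> (act \<beta> x)) \<and>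
     (\<forall>\<alpha> x y. \<rho> (act \<alpha> x) (act \<alpha> y) = \<rho> x y) \<and>
     (\<forall>\<alpha> x. act \<alpha> x = x \<longrightarrow> \<alpha> = 0) \<and>
     (\<forall>x. \<exists>\<alpha> k. x = act \<alpha> (reps k)) \<and>
     (\<forall>\<alpha> \<beta> k k'. act \<alpha> (reps k) = act \<beta> (reps k') \<longrightarrow> k = k')"

definition Umap :: "(int^'n \<Rightarrow> 'x \<Rightarrow> 'x) \<Rightarrow> ('k::finite \<Rightarrow> 'x) \<Rightarrow>
     ('x \<Rightarrow> complex) \<Rightarrow> (int^'n \<Rightarrow> complex^'k)" where
  "Umap act reps f = (\<lambda>\<alpha>. \<chi> k. f (act \<alpha> (reps k)))"

definition Uinv :: "(int^'n \<Rightarrow> 'x \<Rightarrow> 'x) \<Rightarrow> ('k::finite \<Rightarrow> 'x) \<Rightarrow>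
     (int^'n \<Rightarrow> complex^'k) \<Rightarrow> ('x \<Rightarrow> complex)" where
  "Uinv act reps v = (\<lambda>x. case (THE (\<alpha>, k). act \<alpha> (reps k) = x) of (\<alpha>, k) \<Rightarrow> v \<alpha> $ k)"

definition Uconj :: "(int^'n \<Rightarrow> 'x \<Rightarrow> 'x) \<Rightarrow> ('k::finite \<Rightarrow> 'x) \<Rightarrow>
     (('x \<Rightarrow> complex) \<Rightarrow> ('x \<Rightarrow> complex)) \<Rightarrow>
     ((int^'n \<Rightarrow> complex^'k) \<Rightarrow> (int^'n \<Rightarrow> complex^'k))" where
  "Uconj act reps A = (\<lambda>v. Umap act reps (A (Uinv act reps v)))"

end

theory Submission
  imports Defs
begin

text \<open>Since X is the disjoint union of the free orbits of x_1, ..., x_N, U is a relabelling of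
  the points of X by Z^n x {1..N}. The l^p norm over Z^n x {1..N} is the l^p norm over Z^n of
  the fibrewise l^p norms, and on the N-dimensional fibres these are equivalent to the Euclidean
  norm up to the factor N; hence U and its inverse are bounded, conjugation by U preserves
  bounded operators and distorts operator norms by at most N^2. Band operators correspond:
  in orbit coordinates a kernel of band width R only couples cells whose offset gamma satisfies
  rho(x_i, (-gamma) x_j) <= R for some i, j, a finite set since balls are finite and the action
  is free, and the resulting matrix entries form the coefficients a_gamma. Conversely a finite sum
  of shifts has band width the largest such distance over its shifts. The norm bound carries
  approximations by band operators across.\<close>

lemma one_le_enn2real: "1 \<le> (p::ennreal) \<Longrightarrow> p \<noteq> \<infinity> \<Longrightarrow> 1 \<le> enn2real p"
  using enn2real_mono[of 1 p] by (simp add: less_top)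

lemma in_lp_zero: "in_lp p (\<lambda>x. 0)"
  by (simp add: in_lp_def)

lemma lp_norm_zero: "1 \<le> p \<Longrightarrow> lp_norm p (\<lambda>x. 0) = 0"
  using one_le_enn2real[of p] by (simp add: lp_norm_def)

lemma in_lp_finite: "in_lp p (f :: 'a::finite \<Rightarrow> 'b::real_normed_vector)"
  by (simp add: in_lp_def finite_imp_bounded)

lemma norm_le_lp_norm:
  assumes p: "1 \<le> p" and f: "in_lp p f"
  shows "norm (f i) \<le> lp_norm p f"
proof (cases "p = \<infinity>")
  case True
  then have "bdd_above (range (\<lambda>x. norm (f x)))"
    using f by (simp add: in_lp_def bounded_imp_bdd_above)
  then have "norm (f i) \<le> (SUP x. norm (f x))" by (rule cSUP_upper[OF UNIV_I])
  then show ?thesis using True by (simp add: lp_norm_def)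
next
  case False
  define q where "q = enn2real p"
  have q: "1 \<le> q" using one_le_enn2real[OF p False] by (simp add: q_def)
  have "norm (f i) powr q = infsum (\<lambda>x. norm (f x) powr q) {i}" by simp
  also have "\<dots> \<le> infsum (\<lambda>x. norm (f x) powr q) UNIV"
    using f False by (intro infsum_mono_neutral) (auto simp: in_lp_def q_def)
  finally have "(norm (f i) powr q) powr (1/q) \<le> infsum (\<lambda>x. norm (f x) powr q) UNIV powr (1/q)"
    using q by (intro powr_mono2) auto
  then show ?thesis using False q by (simp add: lp_norm_def q_def powr_powr)
qed

lemma lp_norm_nonneg: "1 \<le> p \<Longrightarrow> in_lp p f \<Longrightarrow> 0 \<le> lp_norm p f"
  using norm_le_lp_norm[of p f undefined] norm_ge_zero order_trans by blast

lemma lp_norm_top_le: "(\<And>x. norm (f x) \<le> B) \<Longrightarrow> lp_norm \<infinity> f \<le> B"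
  by (simp add: lp_norm_def cSUP_least)

lemma lp_norm_dominated:
  fixes f :: "'a \<Rightarrow> 'b::real_normed_vector" and g :: "'a \<Rightarrow> 'c::real_normed_vector"
  assumes p: "1 \<le> p" and r: "0 \<le> r" and le: "\<And>x. norm (g x) \<le> r * norm (f x)" and f: "in_lp p f"
  shows "in_lp p g \<and> lp_norm p g \<le> r * lp_norm p f"
proof (cases "p = \<infinity>")
  case True
  have gx: "norm (g x) \<le> r * lp_norm p f" for x
    using le[of x] mult_left_mono[OF norm_le_lp_norm[OF p f, of x] r] by linarith
  then have "bounded (range (\<lambda>x. norm (g x)))" by (auto simp: bounded_iff)
  then show ?thesis using True lp_norm_top_le[OF gx] by (simp add: in_lp_def)
next
  case False
  define q where "q = enn2real p"
  have q: "1 \<le> q" using one_le_enn2real[OF p False] q_def by simp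
  have fs: "(\<lambda>x. norm (f x) powr q) summable_on UNIV" using f False by (simp add: in_lp_def q_def)
  have pw: "norm (g x) powr q \<le> r powr q * norm (f x) powr q" for x
  proof -
    have "norm (g x) powr q \<le> (r * norm (f x)) powr q"
      using le[of x] q by (intro powr_mono2) auto
    also have "\<dots> = r powr q * norm (f x) powr q" using r by (simp add: powr_mult)
    finally show ?thesis .
  qed
  have rfs: "(\<lambda>x. r powr q * norm (f x) powr q) summable_on UNIV"
    by (rule summable_on_cmult_right[OF fs])
  have gs: "(\<lambda>x. norm (g x) powr q) summable_on UNIV"
    by (rule summable_on_comparison_test[OF rfs]) (use pw in auto)
  have "infsum (\<lambda>x. norm (g x) powr q) UNIV \<le> infsum (\<lambda>x. r powr q * norm (f x) powr q) UNIV"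
    by (rule infsum_mono[OF gs rfs]) (use pw in auto)
  also have "\<dots> = r powr q * infsum (\<lambda>x. norm (f x) powr q) UNIV"
    by (rule infsum_cmult_right) (use fs in auto)
  finally have "infsum (\<lambda>x. norm (g x) powr q) UNIV powr (1/q)
      \<le> (r powr q * infsum (\<lambda>x. norm (f x) powr q) UNIV) powr (1/q)"
    using q by (intro powr_mono2) (auto intro: infsum_nonneg)
  also have "\<dots> = r * infsum (\<lambda>x. norm (f x) powr q) UNIV powr (1/q)"
    using r q by (simp add: powr_mult powr_powr infsum_nonneg)
  finally show ?thesis using False gs by (simp add: in_lp_def lp_norm_def q_def)
qed

lemma powr_add_le:
  fixes a b s :: real
  assumes "0 \<le> a" "0 \<le> b" "0 < s"
  shows "(a + b) powr s \<le> 2 powr s * (a powr s + b powr s)"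
proof -
  have "(a + b) powr s \<le> (2 * max a b) powr s"
    using assms by (intro powr_mono2) auto
  also have "\<dots> = 2 powr s * max a b powr s" using assms by (simp add: powr_mult)
  also have "max a b powr s \<le> a powr s + b powr s"
    by (cases "a \<le> b") (auto simp: max_def)
  then have "2 powr s * max a b powr s \<le> 2 powr s * (a powr s + b powr s)"
    by (intro mult_left_mono) auto
  finally show ?thesis .
qed

text \<open>The constant 4 is crude: only the boundedness of differences of bounded operators is needed.\<close>

lemma lp_norm_quasi_triangle:
  fixes f g :: "'a \<Rightarrow> 'b::real_normed_vector" and h :: "'a \<Rightarrow> 'c::real_normed_vector"
  assumes p: "1 \<le> p" and le: "\<And>x. norm (h x) \<le> norm (f x) + norm (g x)"
    and f: "in_lp p f" and g: "in_lp p g"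
  shows "in_lp p h \<and> lp_norm p h \<le> 4 * (lp_norm p f + lp_norm p g)"
proof (cases "p = \<infinity>")
  case True
  have hx: "norm (h x) \<le> 4 * (lp_norm p f + lp_norm p g)" for x
    using le[of x] norm_le_lp_norm[OF p f, of x] norm_le_lp_norm[OF p g, of x]
      lp_norm_nonneg[OF p f] lp_norm_nonneg[OF p g] by (smt (verit))
  then have "bounded (range (\<lambda>x. norm (h x)))" by (auto simp: bounded_iff)
  then show ?thesis using True lp_norm_top_le[OF hx] by (simp add: in_lp_def)
next
  case False
  define q where "q = enn2real p"
  have q: "1 \<le> q" using one_le_enn2real[OF p False] q_def by simp
  have fs: "(\<lambda>x. norm (f x) powr q) summable_on UNIV" using f False by (simp add: in_lp_def q_def)
  have gs: "(\<lambda>x. norm (g x) powr q) summable_on UNIV" using g False by (simp add: in_lp_def q_def)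
  have pw: "norm (h x) powr q \<le> 2 powr q * (norm (f x) powr q + norm (g x) powr q)" for x
  proof -
    have "norm (h x) powr q \<le> (norm (f x) + norm (g x)) powr q"
      using le[of x] q by (intro powr_mono2) auto
    also have "\<dots> \<le> 2 powr q * (norm (f x) powr q + norm (g x) powr q)"
      using q by (intro powr_add_le) auto
    finally show ?thesis .
  qed
  have fgs: "(\<lambda>x. 2 powr q * (norm (f x) powr q + norm (g x) powr q)) summable_on UNIV"
    by (intro summable_on_cmult_right summable_on_add[OF fs gs])
  have hs: "(\<lambda>x. norm (h x) powr q) summable_on UNIV"
    by (rule summable_on_comparison_test[OF fgs]) (use pw in auto)
  define Sf where "Sf = infsum (\<lambda>x. norm (f x) powr q) UNIV"
  define Sg where "Sg = infsum (\<lambda>x. norm (g x) powr q) UNIV"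
  define Sh where "Sh = infsum (\<lambda>x. norm (h x) powr q) UNIV"
  have nn: "0 \<le> Sh" "0 \<le> Sf" "0 \<le> Sg" unfolding Sh_def Sf_def Sg_def by (auto intro!: infsum_nonneg)
  have "Sh \<le> infsum (\<lambda>x. 2 powr q * (norm (f x) powr q + norm (g x) powr q)) UNIV"
    unfolding Sh_def by (rule infsum_mono[OF hs fgs]) (use pw in auto)
  also have "\<dots> = 2 powr q * (Sf + Sg)"
    unfolding Sf_def Sg_def using fs gs by (simp add: infsum_cmult_right' infsum_add)
  finally have "Sh powr (1/q) \<le> (2 powr q * (Sf + Sg)) powr (1/q)"
    using nn q by (intro powr_mono2) auto
  also have "\<dots> = 2 * (Sf + Sg) powr (1/q)"
    using nn q by (simp add: powr_mult powr_powr)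
  also have "(Sf + Sg) powr (1/q) \<le> 2 powr (1/q) * (Sf powr (1/q) + Sg powr (1/q))"
    using nn q by (intro powr_add_le) auto
  also have "\<dots> \<le> 2 * (Sf powr (1/q) + Sg powr (1/q))"
    using q powr_mono[of "1/q" 1 2] by (intro mult_right_mono) auto
  finally show ?thesis using False hs
    by (simp add: in_lp_def lp_norm_def q_def Sh_def Sf_def Sg_def)
qed

lemma lp_norm_le_card_mult:
  fixes f :: "'k::finite \<Rightarrow> 'b::real_normed_vector"
  assumes p: "1 \<le> p" and M: "\<And>i. norm (f i) \<le> M"
  shows "lp_norm p f \<le> real CARD('k) * M"
proof -
  have M0: "0 \<le> M" using M[of undefined] norm_ge_zero order_trans by blast
  have N: "1 \<le> real CARD('k)" by (simp add: Suc_leI)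
  show ?thesis
  proof (cases "p = \<infinity>")
    case True
    have "M \<le> real CARD('k) * M" using N M0 by (simp add: mult_le_cancel_right1)
    with True lp_norm_top_le[of f, OF M] show ?thesis by simp
  next
    case False
    define q where "q = enn2real p"
    have q: "1 \<le> q" using one_le_enn2real[OF p False] q_def by simp
    have "(\<Sum>i\<in>UNIV. norm (f i) powr q) \<le> real CARD('k) * M powr q"
    proof (rule sum_bounded_above)
      fix i show "norm (f i) powr q \<le> M powr q" using M[of i] q by (intro powr_mono2) auto
    qed
    then have "(\<Sum>i\<in>UNIV. norm (f i) powr q) powr (1/q) \<le> (real CARD('k) * M powr q) powr (1/q)"
      using q by (intro powr_mono2) (auto intro: sum_nonneg)
    also have "\<dots> = real CARD('k) powr (1/q) * M"
      using q M0 by (simp add: powr_mult powr_powr)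
    also have "\<dots> \<le> real CARD('k) * M"
      using N q M0 powr_mono[of "1/q" 1 "real CARD('k)"] by (intro mult_right_mono) auto
    finally show ?thesis using False by (simp add: lp_norm_def q_def)
  qed
qed

lemma summable_on_prod_finite_iff:
  fixes f :: "'a \<times> 'k::finite \<Rightarrow> real"
  assumes nonneg: "\<And>z. 0 \<le> f z"
  shows "f summable_on UNIV \<longleftrightarrow> (\<lambda>x. \<Sum>k\<in>UNIV. f (x, k)) summable_on UNIV"
proof
  assume "f summable_on UNIV"
  then show "(\<lambda>x. \<Sum>k\<in>UNIV. f (x, k)) summable_on UNIV"
    using summable_on_SigmaD[of f UNIV "\<lambda>_. UNIV"] by simp
next
  assume "(\<lambda>x. \<Sum>k\<in>UNIV. f (x, k)) summable_on UNIV"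
  then show "f summable_on UNIV"
    using summable_on_SigmaI[of UNIV f "\<lambda>_. UNIV" "\<lambda>x. \<Sum>k\<in>UNIV. f (x, k)"] nonneg by simp
qed

lemma infsum_prod_finite:
  fixes f :: "'a \<times> 'k::finite \<Rightarrow> real"
  assumes nonneg: "\<And>z. 0 \<le> f z"
  shows "infsum f UNIV = infsum (\<lambda>x. \<Sum>k\<in>UNIV. f (x, k)) UNIV"
proof (cases "f summable_on UNIV")
  case True
  then show ?thesis using infsum_Sigma_banach[of f UNIV "\<lambda>_. UNIV"] by simp
next
  case False
  then have "\<not> (\<lambda>x. \<Sum>k\<in>UNIV. f (x, k)) summable_on UNIV"
    using summable_on_prod_finite_iff[of f] nonneg by blast
  with False show ?thesis by (simp add: infsum_not_exists)
qed

lemma lp_norm_prod_finite: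
  fixes f :: "'a \<times> 'k::finite \<Rightarrow> 'b::real_normed_vector"
  assumes p: "1 \<le> p"
  defines "\<sigma> \<equiv> \<lambda>x. lp_norm p (\<lambda>k. f (x, k))"
  shows "(in_lp p f \<longleftrightarrow> in_lp p \<sigma>) \<and> (in_lp p f \<longrightarrow> lp_norm p f = lp_norm p \<sigma>)"
proof -
  have \<sigma>0: "0 \<le> \<sigma> x" for x unfolding \<sigma>_def by (rule lp_norm_nonneg[OF p in_lp_finite])
  have f\<sigma>: "norm (f (x, k)) \<le> norm (\<sigma> x)" for x k
    using \<sigma>0[of x] norm_le_lp_norm[OF p in_lp_finite, of "\<lambda>k. f (x, k)" k] by (simp add: \<sigma>_def)
  show ?thesis
  proof (cases "p = \<infinity>")
    case True
    have \<sigma>le: "norm (\<sigma> x) \<le> B" if "\<And>z. norm (f z) \<le> B" for x B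
      using \<sigma>0[of x] lp_norm_top_le[of "\<lambda>k. f (x, k)" B] True that by (simp add: \<sigma>_def)
    have iff: "in_lp p f \<longleftrightarrow> in_lp p \<sigma>"
    proof
      assume "in_lp p f"
      then obtain B where B: "\<And>z. norm (f z) \<le> B" using True by (auto simp: in_lp_def bounded_iff)
      then show "in_lp p \<sigma>" using True \<sigma>le[OF B] by (auto simp: in_lp_def bounded_iff)
    next
      assume "in_lp p \<sigma>"
      then obtain B where B: "\<And>x. norm (\<sigma> x) \<le> B" using True by (auto simp: in_lp_def bounded_iff)
      have "norm (norm (f z)) \<le> B" for z using f\<sigma>[of "fst z" "snd z"] B[of "fst z"] by simp
      then show "in_lp p f" using True by (auto simp: in_lp_def bounded_iff)
    qed
    have "lp_norm p f = lp_norm p \<sigma>" if f: "in_lp p f"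
    proof (rule antisym)
      show "lp_norm p f \<le> lp_norm p \<sigma>"
      proof -
        have "norm (f z) \<le> lp_norm p \<sigma>" for z
          using f\<sigma>[of "fst z" "snd z"] norm_le_lp_norm[OF p iff[THEN iffD1, OF f], of "fst z"] by simp
        then show ?thesis using True lp_norm_top_le by blast
      qed
      show "lp_norm p \<sigma> \<le> lp_norm p f"
        using True \<sigma>le[OF norm_le_lp_norm[OF p f]] lp_norm_top_le[of \<sigma> "lp_norm p f"] by simp
    qed
    with iff show ?thesis by blast
  next
    case False
    define q where "q = enn2real p"
    have q: "1 \<le> q" using one_le_enn2real[OF p False] q_def by simp
    note q_def[symmetric, simp]
    have \<sigma>q: "\<bar>\<sigma> x\<bar> powr q = (\<Sum>k\<in>UNIV. norm (f (x, k)) powr q)" for x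
      using False q \<sigma>0[of x] by (simp add: \<sigma>_def lp_norm_def powr_powr sum_nonneg)
    show ?thesis
      using False summable_on_prod_finite_iff[of "\<lambda>z. norm (f z) powr q"]
        infsum_prod_finite[of "\<lambda>z. norm (f z) powr q"]
      by (simp add: in_lp_def lp_norm_def \<sigma>q)
  qed
qed

lemma norm_vec_le_sum: "norm (x :: 'b::real_normed_vector^'k) \<le> (\<Sum>i\<in>UNIV. norm (x $ i))"
  unfolding norm_vec_def by (rule L2_set_le_sum) simp

lemma lp_norm_vec_equiv:
  fixes f :: "'a \<times> 'k::finite \<Rightarrow> 'b::real_normed_vector"
  assumes p: "1 \<le> p"
  defines "v \<equiv> \<lambda>x. \<chi> k. f (x, k)"
  shows "(in_lp p f \<longleftrightarrow> in_lp p v) \<and>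
    (in_lp p f \<longrightarrow> lp_norm p v \<le> CARD('k) * lp_norm p f \<and> lp_norm p f \<le> CARD('k) * lp_norm p v)"
proof -
  define \<sigma> where "\<sigma> = (\<lambda>x. lp_norm p (\<lambda>k. f (x, k)))"
  have \<sigma>: "(in_lp p f \<longleftrightarrow> in_lp p \<sigma>) \<and> (in_lp p f \<longrightarrow> lp_norm p f = lp_norm p \<sigma>)"
    unfolding \<sigma>_def by (rule lp_norm_prod_finite[OF p])
  have \<sigma>0: "0 \<le> \<sigma> x" for x unfolding \<sigma>_def by (rule lp_norm_nonneg[OF p in_lp_finite])
  have v\<sigma>: "norm (v x) \<le> CARD('k) * norm (\<sigma> x)" for x
  proof -
    have "norm (v x) \<le> (\<Sum>k\<in>UNIV. norm (f (x, k)))"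
      using norm_vec_le_sum[of "v x"] by (simp add: v_def)
    also have "\<dots> \<le> of_nat (card (UNIV :: 'k set)) * \<sigma> x"
      unfolding \<sigma>_def by (rule sum_bounded_above) (rule norm_le_lp_norm[OF p in_lp_finite])
    finally show ?thesis using \<sigma>0[of x] by simp
  qed
  have \<sigma>v: "norm (\<sigma> x) \<le> CARD('k) * norm (v x)" for x
  proof -
    have "\<sigma> x \<le> CARD('k) * norm (v x)"
      unfolding \<sigma>_def
      by (rule lp_norm_le_card_mult[OF p]) (use Finite_Cartesian_Product.norm_nth_le[of "v x"] in \<open>simp add: v_def\<close>)
    then show ?thesis using \<sigma>0[of x] by simp
  qed
  have "in_lp p \<sigma> \<Longrightarrow> in_lp p v \<and> lp_norm p v \<le> CARD('k) * lp_norm p \<sigma>"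
    using lp_norm_dominated[OF p _ v\<sigma>] by simp
  moreover have "in_lp p v \<Longrightarrow> in_lp p \<sigma> \<and> lp_norm p \<sigma> \<le> CARD('k) * lp_norm p v"
    using lp_norm_dominated[OF p _ \<sigma>v] by simp
  ultimately show ?thesis using \<sigma> by auto
qed

lemma lp_reindex_bij:
  assumes h: "bij h"
  shows "in_lp p (\<lambda>x. f (h x)) \<longleftrightarrow> in_lp p f" and "lp_norm p (\<lambda>x. f (h x)) = lp_norm p f"
proof -
  have "range (\<lambda>x. norm (f (h x))) = range (\<lambda>x. norm (f x))"
    using bij_is_surj[OF h] by (metis image_image)
  moreover have "(\<lambda>x. norm (f (h x)) powr enn2real p) summable_on UNIV
      \<longleftrightarrow> (\<lambda>x. norm (f x) powr enn2real p) summable_on UNIV"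
    by (rule summable_on_reindex_bij_betw[OF h])
  moreover have "infsum (\<lambda>x. norm (f (h x)) powr enn2real p) UNIV
      = infsum (\<lambda>x. norm (f x) powr enn2real p) UNIV"
    by (rule infsum_reindex_bij_betw[OF h])
  ultimately show "in_lp p (\<lambda>x. f (h x)) \<longleftrightarrow> in_lp p f" "lp_norm p (\<lambda>x. f (h x)) = lp_norm p f"
    by (simp_all add: in_lp_def lp_norm_def)
qed

lemma op_norm_bdd_above:
  assumes p: "1 \<le> p" and T: "lp_op p sm T"
  shows "bdd_above {lp_norm p (T u) | u. in_lp p u \<and> lp_norm p u \<le> 1}"
proof -
  obtain C where C: "\<And>u. in_lp p u \<Longrightarrow> lp_norm p (T u) \<le> C * lp_norm p u"
    using T unfolding lp_op_def by blast
  have "lp_norm p (T u) \<le> \<bar>C\<bar>" if u: "in_lp p u" "lp_norm p u \<le> 1" for u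
  proof -
    have "C * lp_norm p u \<le> \<bar>C\<bar> * 1"
      using u lp_norm_nonneg[OF p u(1)] by (intro mult_mono) auto
    then show ?thesis using C[OF u(1)] by simp
  qed
  then show ?thesis by (auto intro!: bdd_aboveI)
qed

lemma op_norm_le:
  fixes T :: "('a \<Rightarrow> 'b::real_normed_vector) \<Rightarrow> ('a \<Rightarrow> 'b)"
  assumes p: "1 \<le> p" and K: "\<And>u. in_lp p u \<Longrightarrow> lp_norm p u \<le> 1 \<Longrightarrow> lp_norm p (T u) \<le> K"
  shows "op_norm p T \<le> K"
  unfolding op_norm_def
proof (rule cSup_least)
  have "in_lp p (\<lambda>x::'a. 0::'b) \<and> lp_norm p (\<lambda>x::'a. 0::'b) \<le> 1"
    by (simp add: in_lp_zero lp_norm_zero[OF p])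
  then show "{lp_norm p (T u) | u. in_lp p u \<and> lp_norm p u \<le> 1} \<noteq> {}" by blast
qed (use K in blast)

lemma lp_norm_le_op_norm_unit:
  assumes p: "1 \<le> p" and T: "lp_op p sm T" and u: "in_lp p u" "lp_norm p u \<le> 1"
  shows "lp_norm p (T u) \<le> op_norm p T"
  unfolding op_norm_def by (rule cSup_upper[OF _ op_norm_bdd_above[OF p T]]) (use u in blast)

lemma op_norm_nonneg:
  assumes p: "1 \<le> p" and T: "lp_op p sm T"
  shows "0 \<le> op_norm p T"
proof -
  have "lp_norm p (T (\<lambda>x. 0)) \<le> op_norm p T"
    by (rule lp_norm_le_op_norm_unit[OF p T in_lp_zero]) (simp add: lp_norm_zero[OF p])
  moreover have "0 \<le> lp_norm p (T (\<lambda>x. 0))"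
    using T in_lp_zero unfolding lp_op_def by (blast intro: lp_norm_nonneg[OF p])
  ultimately show ?thesis by linarith
qed

lemma lp_norm_le_op_norm:
  assumes p: "1 \<le> p" and T: "lp_op p sm T" and sm: "\<And>c z. norm (sm c z) = norm c * norm z"
    and u: "in_lp p u"
  shows "lp_norm p (T u) \<le> op_norm p T * lp_norm p u"
proof -
  have scaled: "t * lp_norm p (T u) \<le> op_norm p T" if t: "0 < t" "t * lp_norm p u \<le> 1" for t
  proof -
    define tu where "tu = (\<lambda>x. sm (complex_of_real t) (u x))"
    have tu: "in_lp p tu \<and> lp_norm p tu \<le> t * lp_norm p u"
      by (rule lp_norm_dominated[OF p _ _ u]) (use t in \<open>auto simp: tu_def sm\<close>)
    have Ttu: "in_lp p (T tu)" using T tu unfolding lp_op_def by blast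
    have "T tu = (\<lambda>x. sm (complex_of_real t) (T u x))"
      using T u unfolding lp_op_def tu_def by blast
    then have "norm (T u x) \<le> (1/t) * norm (T tu x)" for x
      using t by (simp add: sm)
    then have "lp_norm p (T u) \<le> (1/t) * lp_norm p (T tu)"
      using lp_norm_dominated[OF p _ _ Ttu] t by (meson less_eq_real_def zero_le_divide_1_iff)
    moreover have "lp_norm p (T tu) \<le> op_norm p T"
      by (rule lp_norm_le_op_norm_unit[OF p T]) (use tu t in auto)
    ultimately show ?thesis using t by (simp add: field_simps)
  qed
  have o: "0 \<le> op_norm p T" by (rule op_norm_nonneg[OF p T])
  consider "0 < lp_norm p u" | "lp_norm p u = 0"
    using lp_norm_nonneg[OF p u] by linarith
  then show ?thesis
  proof cases
    case 1
    then show ?thesis using scaled[of "1 / lp_norm p u"] by (simp add: field_simps)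
  next
    case 2
    txt \<open>Scaling a null vector with non-null image up would beat the operator norm.\<close>
    show ?thesis
    proof (rule ccontr)
      assume "\<not> ?thesis"
      then have a: "0 < lp_norm p (T u)" using 2 by simp
      have "(op_norm p T + 1) / lp_norm p (T u) * lp_norm p (T u) \<le> op_norm p T"
        using a o 2 by (intro scaled) auto
      then show False using a by simp
    qed
  qed
qed

lemma lp_op_diff:
  assumes p: "1 \<le> p" and sm: "\<And>c a b. sm c (a - b) = sm c a - sm c b"
    and A: "lp_op p sm A" and B: "lp_op p sm B"
  shows "lp_op p sm (\<lambda>u x. A u x - B u x)"
proof -
  obtain Ca where Ca: "\<And>u. in_lp p u \<Longrightarrow> lp_norm p (A u) \<le> Ca * lp_norm p u"
    using A unfolding lp_op_def by blast
  obtain Cb where Cb: "\<And>u. in_lp p u \<Longrightarrow> lp_norm p (B u) \<le> Cb * lp_norm p u"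
    using B unfolding lp_op_def by blast
  have diff: "in_lp p (\<lambda>x. A u x - B u x) \<and>
      lp_norm p (\<lambda>x. A u x - B u x) \<le> 4 * (lp_norm p (A u) + lp_norm p (B u))" if u: "in_lp p u" for u
    by (rule lp_norm_quasi_triangle[OF p]) (use A B u in \<open>auto simp: lp_op_def intro: norm_triangle_ineq4\<close>)
  have "lp_norm p (\<lambda>x. A u x - B u x) \<le> 4 * (\<bar>Ca\<bar> + \<bar>Cb\<bar>) * lp_norm p u" if u: "in_lp p u" for u
  proof -
    have "Ca * lp_norm p u \<le> \<bar>Ca\<bar> * lp_norm p u" "Cb * lp_norm p u \<le> \<bar>Cb\<bar> * lp_norm p u"
      using lp_norm_nonneg[OF p u] by (auto intro: mult_right_mono)
    then show ?thesis using diff[OF u] Ca[OF u] Cb[OF u] by (simp add: algebra_simps)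
  qed
  then show ?thesis
    using A B diff unfolding lp_op_def by (auto simp: sm fun_eq_iff)
qed

text \<open>Additivity and homogeneity are required for all functions, not only on l^p:
  U and its inverse act pointwise, and then conjugation commutes with differences.\<close>

definition bounded_lp_map :: "ennreal \<Rightarrow> (complex \<Rightarrow> 'b \<Rightarrow> 'b) \<Rightarrow> (complex \<Rightarrow> 'd \<Rightarrow> 'd) \<Rightarrow> real \<Rightarrow>
     (('a \<Rightarrow> 'b::real_normed_vector) \<Rightarrow> ('c \<Rightarrow> 'd::real_normed_vector)) \<Rightarrow> bool" where
  "bounded_lp_map p sm sm' C \<Phi> \<longleftrightarrow> 0 \<le> C \<and>
     (\<forall>f g. \<Phi> (\<lambda>x. f x + g x) = (\<lambda>y. \<Phi> f y + \<Phi> g y)) \<and>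
     (\<forall>c f. \<Phi> (\<lambda>x. sm c (f x)) = (\<lambda>y. sm' c (\<Phi> f y))) \<and>
     (\<forall>u. in_lp p u \<longrightarrow> in_lp p (\<Phi> u) \<and> lp_norm p (\<Phi> u) \<le> C * lp_norm p u)"

lemma bounded_lp_map_diff:
  assumes "bounded_lp_map p sm sm' C \<Phi>"
  shows "\<Phi> (\<lambda>x. f x - g x) = (\<lambda>y. \<Phi> f y - \<Phi> g y)"
proof -
  have add: "\<And>f g. \<Phi> (\<lambda>x. f x + g x) = (\<lambda>y. \<Phi> f y + \<Phi> g y)"
    using assms unfolding bounded_lp_map_def by blast
  have "\<Phi> f = \<Phi> (\<lambda>x. (f x - g x) + g x)" by simp
  also have "\<dots> = (\<lambda>y. \<Phi> (\<lambda>x. f x - g x) y + \<Phi> g y)" by (rule add)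
  finally show ?thesis by (simp add: fun_eq_iff)
qed

lemma lp_op_conj:
  assumes p: "1 \<le> p" and A: "lp_op p sm A"
    and \<Phi>: "bounded_lp_map p sm sm' C \<Phi>" and \<Psi>: "bounded_lp_map p sm' sm C' \<Psi>"
  shows "lp_op p sm' (\<lambda>v. \<Phi> (A (\<Psi> v)))"
proof -
  obtain K where K: "\<And>u. in_lp p u \<Longrightarrow> lp_norm p (A u) \<le> K * lp_norm p u"
    using A unfolding lp_op_def by blast
  have "lp_norm p (\<Phi> (A (\<Psi> v))) \<le> (C * \<bar>K\<bar> * C') * lp_norm p v" if v: "in_lp p v" for v
  proof -
    have \<Psi>v: "in_lp p (\<Psi> v)" "lp_norm p (\<Psi> v) \<le> C' * lp_norm p v"
      using \<Psi> v unfolding bounded_lp_map_def by blast+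
    have "lp_norm p (\<Phi> (A (\<Psi> v))) \<le> C * lp_norm p (A (\<Psi> v))"
      using \<Phi> A \<Psi>v unfolding bounded_lp_map_def lp_op_def by blast
    also have "\<dots> \<le> C * (\<bar>K\<bar> * lp_norm p (\<Psi> v))"
    proof -
      have "lp_norm p (A (\<Psi> v)) \<le> \<bar>K\<bar> * lp_norm p (\<Psi> v)"
        using K[OF \<Psi>v(1)] lp_norm_nonneg[OF p \<Psi>v(1)] by (meson abs_ge_self mult_right_mono order_trans)
      then show ?thesis using \<Phi> unfolding bounded_lp_map_def by (simp add: mult_left_mono)
    qed
    also have "\<dots> \<le> C * (\<bar>K\<bar> * (C' * lp_norm p v))"
      using \<Phi> \<Psi>v(2) unfolding bounded_lp_map_def by (intro mult_left_mono) auto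
    finally show ?thesis by (simp add: mult_ac)
  qed
  then show ?thesis
    using A \<Phi> \<Psi> unfolding lp_op_def bounded_lp_map_def by auto
qed

lemma op_norm_conj_le:
  fixes A :: "('a \<Rightarrow> 'b::real_normed_vector) \<Rightarrow> ('a \<Rightarrow> 'b)"
    and \<Phi> :: "('a \<Rightarrow> 'b) \<Rightarrow> ('c \<Rightarrow> 'd::real_normed_vector)" and \<Psi> :: "('c \<Rightarrow> 'd) \<Rightarrow> ('a \<Rightarrow> 'b)"
  assumes p: "1 \<le> p" and A: "lp_op p sm A" and sm: "\<And>c z. norm (sm c z) = norm c * norm z"
    and \<Phi>: "bounded_lp_map p sm sm' C \<Phi>" and \<Psi>: "bounded_lp_map p sm' sm C' \<Psi>"
  shows "op_norm p (\<lambda>v. \<Phi> (A (\<Psi> v))) \<le> C * C' * op_norm p A"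
proof (rule op_norm_le[OF p])
  fix v :: "'c \<Rightarrow> 'd" assume v: "in_lp p v" "lp_norm p v \<le> 1"
  have \<Psi>v: "in_lp p (\<Psi> v)" "lp_norm p (\<Psi> v) \<le> C' * lp_norm p v"
    using \<Psi> v unfolding bounded_lp_map_def by blast+
  have C: "0 \<le> C" "0 \<le> C'" using \<Phi> \<Psi> unfolding bounded_lp_map_def by blast+
  have "lp_norm p (\<Phi> (A (\<Psi> v))) \<le> C * lp_norm p (A (\<Psi> v))"
    using \<Phi> A \<Psi>v unfolding bounded_lp_map_def lp_op_def by blast
  also have "\<dots> \<le> C * (op_norm p A * lp_norm p (\<Psi> v))"
    using C by (intro mult_left_mono lp_norm_le_op_norm[OF p A sm \<Psi>v(1)])
  also have "\<dots> \<le> C * (op_norm p A * (C' * 1))"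
  proof -
    have "lp_norm p (\<Psi> v) \<le> C' * 1"
      using \<Psi>v(2) mult_left_mono[OF v(2) C(2)] by linarith
    then show ?thesis using C op_norm_nonneg[OF p A] by (intro mult_left_mono) auto
  qed
  finally show "lp_norm p (\<Phi> (A (\<Psi> v))) \<le> C * C' * op_norm p A" by (simp add: mult_ac)
qed

definition approximable :: "ennreal \<Rightarrow> ((('a \<Rightarrow> 'b) \<Rightarrow> ('a \<Rightarrow> 'b)) \<Rightarrow> bool) \<Rightarrow>
     (('a \<Rightarrow> 'b::real_normed_vector) \<Rightarrow> ('a \<Rightarrow> 'b)) \<Rightarrow> bool" where
  "approximable p P A \<longleftrightarrow> (\<forall>\<epsilon>>0. \<exists>B. P B \<and> op_norm p (\<lambda>u x. A u x - B u x) < \<epsilon>)"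

lemma approximable_conj:
  assumes p: "1 \<le> p" and sm: "\<And>c z. norm (sm c z) = norm c * norm z"
    and sm_diff: "\<And>c a b. sm c (a - b) = sm c a - sm c b"
    and \<Phi>: "bounded_lp_map p sm sm' C \<Phi>" and \<Psi>: "bounded_lp_map p sm' sm C' \<Psi>"
    and A: "lp_op p sm A" "approximable p P A"
    and PQ: "\<And>B. P B \<Longrightarrow> lp_op p sm B \<and> Q (\<lambda>v. \<Phi> (B (\<Psi> v)))"
  shows "approximable p Q (\<lambda>v. \<Phi> (A (\<Psi> v)))"
  unfolding approximable_def
proof (intro allI impI)
  fix \<epsilon> :: real assume \<epsilon>: "0 < \<epsilon>"
  have CC': "0 \<le> C * C'" using \<Phi> \<Psi> unfolding bounded_lp_map_def by simp
  have "0 < \<epsilon> / (C * C' + 1)" using \<epsilon> CC' by simp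
  then obtain B where B: "P B" and AB: "op_norm p (\<lambda>u x. A u x - B u x) < \<epsilon> / (C * C' + 1)"
    using A(2) unfolding approximable_def by blast
  have conj_diff: "(\<lambda>v x. \<Phi> (A (\<Psi> v)) x - \<Phi> (B (\<Psi> v)) x) = (\<lambda>v. \<Phi> ((\<lambda>u x. A u x - B u x) (\<Psi> v)))"
    using bounded_lp_map_diff[OF \<Phi>] by simp
  have "op_norm p (\<lambda>v. \<Phi> ((\<lambda>u x. A u x - B u x) (\<Psi> v))) \<le> C * C' * op_norm p (\<lambda>u x. A u x - B u x)"
    using PQ[OF B] by (intro op_norm_conj_le[OF p _ sm \<Phi> \<Psi>] lp_op_diff[OF p sm_diff A(1)]) auto
  also have "\<dots> \<le> C * C' * (\<epsilon> / (C * C' + 1))"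
    using AB CC' by (intro mult_left_mono) auto
  also have "\<dots> < \<epsilon>"
    using \<epsilon> CC' by (simp add: field_simps)
  finally have "op_norm p (\<lambda>v x. \<Phi> (A (\<Psi> v)) x - \<Phi> (B (\<Psi> v)) x) < \<epsilon>"
    by (simp only: conj_diff)
  with PQ[OF B] show "\<exists>B'. Q B' \<and> op_norm p (\<lambda>u x. \<Phi> (A (\<Psi> u)) x - B' u x) < \<epsilon>"
    by blast
qed

lemma norm_matrix_le:
  fixes m :: "'b::real_normed_vector^'k^'l"
  assumes "\<And>i j. norm (m $ i $ j) \<le> M"
  shows "norm m \<le> real CARD('l) * (real CARD('k) * M)"
proof -
  have "norm (m $ i) \<le> real CARD('k) * M" for i
    using norm_vec_le_sum[of "m $ i"] sum_bounded_above[of UNIV "\<lambda>j. norm (m $ i $ j)" M] assms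
    by simp
  then show ?thesis
    using norm_vec_le_sum[of m] sum_bounded_above[of UNIV "\<lambda>i. norm (m $ i)"] by fastforce
qed

lemma norm_smult_vec: "norm (c *s (x :: 'a::real_normed_div_algebra^'k)) = norm c * norm x"
proof -
  have "norm (c *s x) = L2_set (\<lambda>i. norm c * norm (x $ i)) UNIV"
    unfolding norm_vec_def by (simp add: norm_mult)
  also have "\<dots> = norm c * norm x"
    unfolding norm_vec_def by (rule L2_set_right_distrib[symmetric]) simp
  finally show ?thesis .
qed

definition Uconj_inv :: "(int^'n \<Rightarrow> 'x \<Rightarrow> 'x) \<Rightarrow> ('k::finite \<Rightarrow> 'x) \<Rightarrow>
     ((int^'n \<Rightarrow> complex^'k) \<Rightarrow> (int^'n \<Rightarrow> complex^'k)) \<Rightarrow>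
     (('x \<Rightarrow> complex) \<Rightarrow> ('x \<Rightarrow> complex))" where
  "Uconj_inv act reps B = (\<lambda>u. Uinv act reps (B (Umap act reps u)))"

lemma Umap_add: "Umap act reps (\<lambda>x. f x + g x) = (\<lambda>\<alpha>. Umap act reps f \<alpha> + Umap act reps g \<alpha>)"
  by (simp add: Umap_def fun_eq_iff vec_eq_iff)

lemma Umap_cmult: "Umap act reps (\<lambda>x. c * f x) = (\<lambda>\<alpha>. c *s Umap act reps f \<alpha>)"
  by (simp add: Umap_def fun_eq_iff vec_eq_iff)

locale periodic_space =
  fixes \<rho> :: "'x \<Rightarrow> 'x \<Rightarrow> real" and act :: "int^'n \<Rightarrow> 'x \<Rightarrow> 'x" and reps :: "'k::finite \<Rightarrow> 'x"
  assumes periodic: "periodic_discrete_metric_space \<rho> act reps"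
begin

lemma act_add: "act (\<alpha> + \<beta>) x = act \<alpha> (act \<beta> x)"
  using periodic by (simp add: periodic_discrete_metric_space_def)

lemma dist_act: "\<rho> (act \<alpha> x) (act \<alpha> y) = \<rho> x y"
  using periodic by (simp add: periodic_discrete_metric_space_def)

lemma act_free: "act \<alpha> x = x \<Longrightarrow> \<alpha> = 0"
  using periodic unfolding periodic_discrete_metric_space_def by (elim conjE) blast

lemma orbit_rep: "\<exists>\<alpha> k. x = act \<alpha> (reps k)"
  using periodic by (simp add: periodic_discrete_metric_space_def)

lemma orbits_distinct: "act \<alpha> (reps k) = act \<beta> (reps k') \<Longrightarrow> k = k'"
  using periodic by (simp add: periodic_discrete_metric_space_def)

lemma finite_ball: "finite {y. \<rho> x y \<le> r}"
  using periodic unfolding periodic_discrete_metric_space_def by (elim conjE) blast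

lemma act_reps_eq_iff: "act \<alpha> (reps i) = act \<beta> (reps j) \<longleftrightarrow> \<alpha> = \<beta> \<and> i = j"
proof
  assume h: "act \<alpha> (reps i) = act \<beta> (reps j)"
  then have ij: "i = j" by (rule orbits_distinct)
  have "act (\<alpha> - \<beta>) (act \<beta> (reps j)) = act \<alpha> (reps j)" by (simp flip: act_add)
  then have "\<alpha> - \<beta> = 0" using h ij by (intro act_free) simp
  then show "\<alpha> = \<beta> \<and> i = j" using ij by simp
qed auto

lemma bij_act_reps: "bij (\<lambda>(\<alpha>, i). act \<alpha> (reps i))"
proof (rule bijI)
  show "inj (\<lambda>(\<alpha>, i). act \<alpha> (reps i))" by (auto intro!: injI simp: act_reps_eq_iff)
  have "x \<in> range (\<lambda>(\<alpha>, i). act \<alpha> (reps i))" for x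
  proof -
    obtain \<alpha> k where "x = act \<alpha> (reps k)" using orbit_rep by blast
    then show ?thesis by (auto intro: image_eqI[of _ _ "(\<alpha>, k)"])
  qed
  then show "surj (\<lambda>(\<alpha>, i). act \<alpha> (reps i))" by blast
qed

lemma dist_act_shift: "\<rho> (act \<alpha> x) (act \<beta> y) = \<rho> x (act (\<beta> - \<alpha>) y)"
proof -
  have "act \<beta> y = act \<alpha> (act (\<beta> - \<alpha>) y)" by (simp flip: act_add)
  then show ?thesis by (simp add: dist_act)
qed

lemma Uinv_act [simp]: "Uinv act reps v (act \<alpha> (reps i)) = v \<alpha> $ i"
proof -
  have "(THE (\<beta>, k). act \<beta> (reps k) = act \<alpha> (reps i)) = (\<alpha>, i)"
    by (rule the_equality) (auto simp: act_reps_eq_iff)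
  then show ?thesis by (simp add: Uinv_def)
qed

lemma Umap_nth [simp]: "Umap act reps f \<alpha> $ i = f (act \<alpha> (reps i))"
  by (simp add: Umap_def)

lemma Umap_Uinv [simp]: "Umap act reps (Uinv act reps v) = v"
  by (simp add: vec_eq_iff fun_eq_iff)

lemma eq_on_orbits: "(\<And>\<alpha> i. f (act \<alpha> (reps i)) = g (act \<alpha> (reps i))) \<Longrightarrow> f = g"
  using orbit_rep by (metis ext)

lemma Uinv_Umap [simp]: "Uinv act reps (Umap act reps f) = f"
  by (rule eq_on_orbits) simp

lemma lp_norm_Umap_equiv:
  assumes p: "1 \<le> p"
  shows "(in_lp p f \<longleftrightarrow> in_lp p (Umap act reps f)) \<and>
    (in_lp p f \<longrightarrow> lp_norm p (Umap act reps f) \<le> CARD('k) * lp_norm p f \<and>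
        lp_norm p f \<le> CARD('k) * lp_norm p (Umap act reps f))"
proof -
  define g where "g = (\<lambda>z. f ((\<lambda>(\<alpha>, i). act \<alpha> (reps i)) z))"
  have "Umap act reps f = (\<lambda>\<alpha>. \<chi> i. g (\<alpha>, i))" by (simp add: Umap_def g_def)
  moreover have "in_lp p g \<longleftrightarrow> in_lp p f" "lp_norm p g = lp_norm p f"
    unfolding g_def by (rule lp_reindex_bij[OF bij_act_reps])+
  ultimately show ?thesis using lp_norm_vec_equiv[OF p, of g] by simp
qed

lemma bounded_lp_map_Umap: "1 \<le> p \<Longrightarrow> bounded_lp_map p (*) (*s) CARD('k) (Umap act reps)"
  using lp_norm_Umap_equiv by (auto simp: bounded_lp_map_def Umap_add Umap_cmult)

lemma bounded_lp_map_Uinv: "1 \<le> p \<Longrightarrow> bounded_lp_map p (*s) (*) CARD('k) (Uinv act reps)"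
  using lp_norm_Umap_equiv[of p "Uinv act reps v" for v]
  by (auto simp: bounded_lp_map_def intro!: eq_on_orbits)

lemma sum_over_orbit_shifts:
  fixes F :: "'x \<Rightarrow> 'a::comm_monoid_add"
  assumes S: "finite S" and T: "finite T"
    and nz: "\<And>y. F y \<noteq> 0 \<Longrightarrow> y \<in> T \<and> (\<exists>\<gamma>\<in>S. \<exists>j. y = act (\<alpha> - \<gamma>) (reps j))"
  shows "sum F T = (\<Sum>\<gamma>\<in>S. \<Sum>j\<in>UNIV. F (act (\<alpha> - \<gamma>) (reps j)))"
proof -
  define \<psi> where "\<psi> = (\<lambda>(\<gamma>, j). act (\<alpha> - \<gamma>) (reps j))"
  define I where "I = \<psi> ` (S \<times> UNIV)"
  have inj: "inj_on \<psi> (S \<times> UNIV)" unfolding \<psi>_def by (auto intro!: inj_onI simp: act_reps_eq_iff)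
  have "y \<in> I" if Fy: "F y \<noteq> 0" for y
  proof -
    obtain \<gamma> j where "\<gamma> \<in> S" "y = act (\<alpha> - \<gamma>) (reps j)" using nz[OF Fy] by blast
    then show ?thesis by (auto simp: I_def \<psi>_def intro!: image_eqI[of _ _ "(\<gamma>, j)"])
  qed
  moreover have "finite I" unfolding I_def using S by simp
  ultimately have I: "finite I" "\<And>y. F y \<noteq> 0 \<Longrightarrow> y \<in> I" by blast+
  have "sum F T = sum F (T \<union> I)"
    by (rule sum.mono_neutral_left) (use T I nz in auto)
  also have "\<dots> = sum F I"
    by (rule sum.mono_neutral_right) (use T I in auto)
  also have "\<dots> = sum (F \<circ> \<psi>) (S \<times> UNIV)" unfolding I_def by (rule sum.reindex[OF inj])
  also have "\<dots> = (\<Sum>\<gamma>\<in>S. \<Sum>j\<in>UNIV. F (act (\<alpha> - \<gamma>) (reps j)))"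
    by (simp add: sum.cartesian_product \<psi>_def case_prod_beta')
  finally show ?thesis .
qed

lemma finite_band_shifts: "finite {\<gamma>. \<exists>i j. \<rho> (reps i) (act (-\<gamma>) (reps j)) \<le> R}"
proof -
  have "finite ((\<lambda>\<gamma>. act (-\<gamma>) (reps j)) -` {y. \<rho> (reps i) y \<le> R})" for i j
    by (rule finite_vimageI[OF finite_ball]) (auto intro!: injI simp: act_reps_eq_iff)
  moreover have "{\<gamma>. \<exists>i j. \<rho> (reps i) (act (-\<gamma>) (reps j)) \<le> R}
      = (\<Union>(i, j)\<in>UNIV. (\<lambda>\<gamma>. act (-\<gamma>) (reps j)) -` {y. \<rho> (reps i) y \<le> R})"
    by auto
  ultimately show ?thesis by simp
qed

lemma band_sum_in_orbit_coordinates: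
  fixes k :: "'x \<Rightarrow> 'x \<Rightarrow> complex" and \<alpha> :: "int^'n" and i :: 'k
  assumes kR: "\<And>x y. R < \<rho> x y \<Longrightarrow> k x y = 0"
  defines "x \<equiv> act \<alpha> (reps i)"
  shows "(\<Sum>y\<in>{y. \<rho> x y \<le> R}. k x y * w y)
    = (\<Sum>\<gamma>\<in>{\<gamma>. \<exists>i j. \<rho> (reps i) (act (-\<gamma>) (reps j)) \<le> R}.
         \<Sum>j\<in>UNIV. k x (act (\<alpha> - \<gamma>) (reps j)) * w (act (\<alpha> - \<gamma>) (reps j)))"
proof (rule sum_over_orbit_shifts[OF finite_band_shifts finite_ball])
  fix y assume "k x y * w y \<noteq> 0"
  then have yR: "\<rho> x y \<le> R" using kR by force
  obtain \<beta> j where y: "y = act \<beta> (reps j)" using orbit_rep by blast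
  have "\<rho> (reps i) (act (-(\<alpha> - \<beta>)) (reps j)) \<le> R"
    using yR unfolding x_def y dist_act_shift by simp
  moreover have "y = act (\<alpha> - (\<alpha> - \<beta>)) (reps j)" using y by simp
  ultimately show "y \<in> {y. \<rho> x y \<le> R} \<and>
      (\<exists>\<gamma>\<in>{\<gamma>. \<exists>i j. \<rho> (reps i) (act (-\<gamma>) (reps j)) \<le> R}. \<exists>j. y = act (\<alpha> - \<gamma>) (reps j))"
    using yR by blast
qed

lemma band_op_Uconj:
  assumes p: "1 \<le> p" and B: "band_op_X p \<rho> B"
  shows "band_op_Z p (Uconj act reps B)"
proof -
  obtain k R M where kM: "\<And>x y. norm (k x y) \<le> M" and kR: "\<And>x y. \<rho> x y > R \<Longrightarrow> k x y = 0"
    and kB: "\<And>u. in_lp p u \<Longrightarrow> B u = (\<lambda>x. \<Sum>y\<in>{y. \<rho> x y \<le> R}. k x y * u y)"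
    using B unfolding band_op_X_def by blast
  define S where "S = {\<gamma>. \<exists>i j. \<rho> (reps i) (act (-\<gamma>) (reps j)) \<le> R}"
  define a where "a = (\<lambda>\<gamma> \<alpha>. \<chi> i j. k (act \<alpha> (reps i)) (act (\<alpha> - \<gamma>) (reps j)))"
  have aM: "norm (a \<gamma> \<alpha>) \<le> real CARD('k) * (real CARD('k) * M)" for \<gamma> \<alpha>
    by (rule norm_matrix_le) (simp add: a_def kM)
  have "finite S" unfolding S_def by (rule finite_band_shifts)
  have lp: "lp_op p (*s) (Uconj act reps B)"
    using B lp_op_conj[OF p _ bounded_lp_map_Umap[OF p] bounded_lp_map_Uinv[OF p]]
    by (simp add: band_op_X_def Uconj_def)
  have "Uconj act reps B v = (\<lambda>\<alpha>. \<Sum>\<gamma>\<in>S. a \<gamma> \<alpha> *v v (\<alpha> - \<gamma>))" if v: "in_lp p v" for v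
  proof -
    have w: "in_lp p (Uinv act reps v)" using lp_norm_Umap_equiv[OF p] v by simp
    have "Uconj act reps B v \<alpha> $ i = (\<Sum>\<gamma>\<in>S. a \<gamma> \<alpha> *v v (\<alpha> - \<gamma>)) $ i" for \<alpha> i
    proof -
      have "Uconj act reps B v \<alpha> $ i
          = (\<Sum>y\<in>{y. \<rho> (act \<alpha> (reps i)) y \<le> R}. k (act \<alpha> (reps i)) y * Uinv act reps v y)"
        using w by (simp add: Uconj_def kB)
      also have "\<dots> = (\<Sum>\<gamma>\<in>S. \<Sum>j\<in>UNIV. k (act \<alpha> (reps i)) (act (\<alpha> - \<gamma>) (reps j))
          * Uinv act reps v (act (\<alpha> - \<gamma>) (reps j)))"
        unfolding S_def by (rule band_sum_in_orbit_coordinates[OF kR])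
      also have "\<dots> = (\<Sum>\<gamma>\<in>S. a \<gamma> \<alpha> *v v (\<alpha> - \<gamma>)) $ i"
        by (simp add: sum_component matrix_vector_mult_def a_def)
      finally show ?thesis .
    qed
    then show ?thesis by (simp add: fun_eq_iff vec_eq_iff)
  qed
  then show ?thesis
    unfolding band_op_Z_def using lp \<open>finite S\<close> aM by blast
qed

lemma band_width_of_shifts:
  assumes S: "finite S"
  obtains R where "\<And>\<alpha> \<beta> i j. \<alpha> - \<beta> \<in> S \<Longrightarrow> \<rho> (act \<alpha> (reps i)) (act \<beta> (reps j)) \<le> R"
proof
  define d where "d = (\<lambda>(\<gamma>, i, j). \<rho> (reps i) (act (-\<gamma>) (reps j)))"
  fix \<alpha> \<beta> i j assume "\<alpha> - \<beta> \<in> S"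
  then have "d (\<alpha> - \<beta>, i, j) \<le> Max (d ` (S \<times> UNIV \<times> UNIV))"
    using S by (intro Max_ge imageI) auto
  then show "\<rho> (act \<alpha> (reps i)) (act \<beta> (reps j)) \<le> Max (d ` (S \<times> UNIV \<times> UNIV))"
    by (simp add: d_def dist_act_shift)
qed

definition shift_kernel :: "(int^'n) set \<Rightarrow> (int^'n \<Rightarrow> int^'n \<Rightarrow> complex^'k^'k) \<Rightarrow> 'x \<Rightarrow> 'x \<Rightarrow> complex"
  where "shift_kernel S a x y =
    (let (\<alpha>, i) = inv (\<lambda>(\<alpha>, i). act \<alpha> (reps i)) x; (\<beta>, j) = inv (\<lambda>(\<alpha>, i). act \<alpha> (reps i)) y in
      if \<alpha> - \<beta> \<in> S then a (\<alpha> - \<beta>) \<alpha> $ i $ j else 0)"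

lemma shift_kernel_act [simp]:
  "shift_kernel S a (act \<alpha> (reps i)) (act \<beta> (reps j)) = (if \<alpha> - \<beta> \<in> S then a (\<alpha> - \<beta>) \<alpha> $ i $ j else 0)"
  using inv_f_f[OF bij_is_inj[OF bij_act_reps], of "(\<alpha>, i)"] inv_f_f[OF bij_is_inj[OF bij_act_reps], of "(\<beta>, j)"]
  by (simp add: shift_kernel_def)

lemma band_op_Uconj_inv:
  assumes p: "1 \<le> p" and B: "band_op_Z p B"
  shows "band_op_X p \<rho> (Uconj_inv act reps B)"
proof -
  obtain S and a :: "int^'n \<Rightarrow> int^'n \<Rightarrow> complex^'k^'k" and M where S: "finite S"
    and aM: "\<And>\<gamma> x. \<gamma> \<in> S \<Longrightarrow> norm (a \<gamma> x) \<le> M"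
    and aB: "\<And>v. in_lp p v \<Longrightarrow> B v = (\<lambda>x. \<Sum>\<gamma>\<in>S. a \<gamma> x *v v (x - \<gamma>))"
    using B unfolding band_op_Z_def by blast
  obtain R where R: "\<And>\<alpha> \<beta> i j. \<alpha> - \<beta> \<in> S \<Longrightarrow> \<rho> (act \<alpha> (reps i)) (act \<beta> (reps j)) \<le> R"
    using band_width_of_shifts[OF S] by blast
  define k where "k = shift_kernel S a"
  have kM: "norm (k x y) \<le> max M 0" for x y
  proof -
    obtain \<alpha> i \<beta> j where xy: "x = act \<alpha> (reps i)" "y = act \<beta> (reps j)" using orbit_rep by meson
    have "norm (a \<gamma> \<alpha> $ i $ j) \<le> M" if "\<gamma> \<in> S" for \<gamma>
      using Finite_Cartesian_Product.norm_nth_le[of "a \<gamma> \<alpha> $ i" j]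
        Finite_Cartesian_Product.norm_nth_le[of "a \<gamma> \<alpha>" i] aM[OF that, of \<alpha>] by linarith
    then show ?thesis by (force simp: xy k_def)
  qed
  have kR: "k x y = 0" if "\<rho> x y > R" for x y
  proof -
    obtain \<alpha> i \<beta> j where xy: "x = act \<alpha> (reps i)" "y = act \<beta> (reps j)" using orbit_rep by meson
    show ?thesis using R[of \<alpha> \<beta> i j] that by (auto simp: xy k_def)
  qed
  have "Uconj_inv act reps B u = (\<lambda>x. \<Sum>y\<in>{y. \<rho> x y \<le> R}. k x y * u y)" if u: "in_lp p u" for u
  proof (rule eq_on_orbits)
    fix \<alpha> i
    have w: "in_lp p (Umap act reps u)" using lp_norm_Umap_equiv[OF p] u by blast
    have "Uconj_inv act reps B u (act \<alpha> (reps i)) = (\<Sum>\<gamma>\<in>S. a \<gamma> \<alpha> *v Umap act reps u (\<alpha> - \<gamma>)) $ i"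
      by (simp add: Uconj_inv_def aB[OF w])
    also have "\<dots> = (\<Sum>\<gamma>\<in>S. \<Sum>j\<in>UNIV. k (act \<alpha> (reps i)) (act (\<alpha> - \<gamma>) (reps j))
        * u (act (\<alpha> - \<gamma>) (reps j)))"
      by (simp add: sum_component matrix_vector_mult_def k_def)
    also have "\<dots> = (\<Sum>y\<in>{y. \<rho> (act \<alpha> (reps i)) y \<le> R}. k (act \<alpha> (reps i)) y * u y)"
    proof (rule sum_over_orbit_shifts[OF S finite_ball, symmetric])
      fix y assume nz: "k (act \<alpha> (reps i)) y * u y \<noteq> 0"
      obtain \<beta> j where y: "y = act \<beta> (reps j)" using orbit_rep by blast
      have \<beta>: "\<alpha> - \<beta> \<in> S" using nz by (auto simp: y k_def split: if_splits)
      then show "y \<in> {y. \<rho> (act \<alpha> (reps i)) y \<le> R} \<and> (\<exists>\<gamma>\<in>S. \<exists>j. y = act (\<alpha> - \<gamma>) (reps j))"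
        using R[OF \<beta>, of i j] y by (auto intro!: bexI[OF _ \<beta>])
    qed
    finally show "Uconj_inv act reps B u (act \<alpha> (reps i))
        = (\<lambda>x. \<Sum>y\<in>{y. \<rho> x y \<le> R}. k x y * u y) (act \<alpha> (reps i))" by simp
  qed
  moreover have "lp_op p (*) (Uconj_inv act reps B)"
    using B lp_op_conj[OF p _ bounded_lp_map_Uinv[OF p] bounded_lp_map_Umap[OF p]]
    by (simp add: band_op_Z_def Uconj_inv_def)
  ultimately show ?thesis
    unfolding band_op_X_def using kM kR by blast
qed

lemma Uconj_in_Ap_Z:
  assumes p: "1 \<le> p" and A: "A \<in> Ap_X p \<rho>"
  shows "Uconj act reps A \<in> Ap_Z p"
proof -
  have A': "lp_op p (*) A" "approximable p (band_op_X p \<rho>) A"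
    using A by (simp_all add: Ap_X_def approximable_def)
  have "approximable p (band_op_Z p) (\<lambda>v. Umap act reps (A (Uinv act reps v)))"
    using band_op_Uconj[OF p]
    by (intro approximable_conj[OF p _ _ bounded_lp_map_Umap[OF p] bounded_lp_map_Uinv[OF p] A'])
      (auto simp: norm_mult right_diff_distrib band_op_X_def Uconj_def)
  moreover have "lp_op p (*s) (\<lambda>v. Umap act reps (A (Uinv act reps v)))"
    by (rule lp_op_conj[OF p A'(1) bounded_lp_map_Umap[OF p] bounded_lp_map_Uinv[OF p]])
  ultimately show ?thesis by (simp add: Ap_Z_def approximable_def Uconj_def)
qed

lemma Uconj_inv_in_Ap_X:
  assumes p: "1 \<le> p" and B: "B \<in> Ap_Z p"
  shows "Uconj_inv act reps B \<in> Ap_X p \<rho>"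
proof -
  have B': "lp_op p (*s) B" "approximable p (band_op_Z p) B"
    using B by (simp_all add: Ap_Z_def approximable_def)
  have "approximable p (band_op_X p \<rho>) (\<lambda>u. Uinv act reps (B (Umap act reps u)))"
    using band_op_Uconj_inv[OF p]
    by (intro approximable_conj[OF p _ _ bounded_lp_map_Uinv[OF p] bounded_lp_map_Umap[OF p] B'])
      (auto simp: norm_smult_vec vec_eq_iff right_diff_distrib band_op_Z_def Uconj_inv_def)
  moreover have "lp_op p (*) (\<lambda>u. Uinv act reps (B (Umap act reps u)))"
    by (rule lp_op_conj[OF p B'(1) bounded_lp_map_Uinv[OF p] bounded_lp_map_Umap[OF p]])
  ultimately show ?thesis by (simp add: Ap_X_def approximable_def Uconj_inv_def)
qed

lemma Uconj_Uconj_inv [simp]: "Uconj act reps (Uconj_inv act reps B) = B"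
  by (simp add: Uconj_def Uconj_inv_def)

lemma Uconj_inv_Uconj [simp]: "Uconj_inv act reps (Uconj act reps A) = A"
  by (simp add: Uconj_def Uconj_inv_def)

lemma Uconj_eq_imp_eq:
  assumes p: "1 \<le> p" and eq: "\<And>v. in_lp p v \<Longrightarrow> Uconj act reps A v = Uconj act reps A' v"
    and u: "in_lp p u"
  shows "A u = A' u"
proof -
  have "Umap act reps (A u) = Umap act reps (A' u)"
    using eq[of "Umap act reps u"] lp_norm_Umap_equiv[OF p, of u] u by (simp add: Uconj_def)
  then show ?thesis by (metis Uinv_Umap)
qed

lemma op_norm_Uconj_le:
  assumes p: "1 \<le> p" and A: "lp_op p (*) A"
  shows "op_norm p (Uconj act reps A) \<le> real CARD('k)^2 * op_norm p A"
  unfolding Uconj_def power2_eq_square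
  by (rule op_norm_conj_le[OF p A _ bounded_lp_map_Umap[OF p] bounded_lp_map_Uinv[OF p]])
    (simp add: norm_mult)

lemma op_norm_le_Uconj:
  assumes p: "1 \<le> p" and A: "lp_op p (*) A"
  shows "op_norm p A \<le> real CARD('k)^2 * op_norm p (Uconj act reps A)"
proof -
  have "lp_op p (*s) (Uconj act reps A)"
    unfolding Uconj_def by (rule lp_op_conj[OF p A bounded_lp_map_Umap[OF p] bounded_lp_map_Uinv[OF p]])
  then have "op_norm p (Uconj_inv act reps (Uconj act reps A))
      \<le> real CARD('k)^2 * op_norm p (Uconj act reps A)"
    unfolding Uconj_inv_def power2_eq_square
    by (rule op_norm_conj_le[OF p _ _ bounded_lp_map_Uinv[OF p] bounded_lp_map_Umap[OF p]])
      (simp add: norm_smult_vec)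
  then show ?thesis by simp
qed

end

theorem proposition3p2:
  fixes \<rho> :: "'x \<Rightarrow> 'x \<Rightarrow> real"
    and act :: "int^'n \<Rightarrow> 'x \<Rightarrow> 'x"
    and reps :: "'k::finite \<Rightarrow> 'x"
    and p :: ennreal
  assumes X: "periodic_discrete_metric_space \<rho> act reps"
    and p: "1 \<le> p"
  shows
    "(\<forall>A \<in> Ap_X p \<rho>. Uconj act reps A \<in> Ap_Z p) \<and>
     (\<forall>B \<in> Ap_Z p. \<exists>A \<in> Ap_X p \<rho>. \<forall>v. in_lp p v \<longrightarrow> Uconj act reps A v = B v) \<and>
     (\<forall>A \<in> Ap_X p \<rho>. \<forall>A' \<in> Ap_X p \<rho>.
        (\<forall>v. in_lp p v \<longrightarrow> Uconj act reps A v = Uconj act reps A' v) \<longrightarrow>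
        (\<forall>u. in_lp p u \<longrightarrow> A u = A' u)) \<and>
     (\<forall>A \<in> Ap_X p \<rho>. \<forall>A' \<in> Ap_X p \<rho>. \<forall>v. in_lp p v \<longrightarrow>
        Uconj act reps (\<lambda>u x. A u x + A' u x) v =
          (\<lambda>\<alpha>. Uconj act reps A v \<alpha> + Uconj act reps A' v \<alpha>)) \<and>
     (\<forall>A \<in> Ap_X p \<rho>. \<forall>c. \<forall>v. in_lp p v \<longrightarrow>
        Uconj act reps (\<lambda>u x. c * A u x) v = (\<lambda>\<alpha>. c *s Uconj act reps A v \<alpha>)) \<and>
     (\<forall>A \<in> Ap_X p \<rho>. \<forall>A' \<in> Ap_X p \<rho>. \<forall>v. in_lp p v \<longrightarrow>
        Uconj act reps (A \<circ> A') v = (Uconj act reps A \<circ> Uconj act reps A') v) \<and>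
     (\<forall>v. in_lp p v \<longrightarrow> Uconj act reps id v = v) \<and>
     (\<exists>C>0. \<forall>A \<in> Ap_X p \<rho>.
        op_norm p (Uconj act reps A) \<le> C * op_norm p A \<and>
        op_norm p A \<le> C * op_norm p (Uconj act reps A))"
proof -
  interpret periodic_space \<rho> act reps by (rule periodic_space.intro[OF X])
  have "\<exists>C>0. \<forall>A \<in> Ap_X p \<rho>.
      op_norm p (Uconj act reps A) \<le> C * op_norm p A \<and> op_norm p A \<le> C * op_norm p (Uconj act reps A)"
    using op_norm_Uconj_le[OF p] op_norm_le_Uconj[OF p]
    by (intro exI[of _ "real CARD('k)^2"]) (simp add: Ap_X_def)
  then show ?thesis
    apply (intro conjI)
    subgoal using Uconj_in_Ap_Z[OF p] by blast
    subgoal using Uconj_inv_in_Ap_X[OF p] Uconj_Uconj_inv by metis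
    subgoal using Uconj_eq_imp_eq[OF p] by blast
    subgoal by (simp add: Uconj_def Umap_add)
    subgoal by (simp add: Uconj_def Umap_cmult)
    subgoal by (simp add: Uconj_def)
    subgoal by (simp add: Uconj_def)
    subgoal by assumption
    done
qed

end
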